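(* Let $d\ge1$ be an integer, let $\alpha\in(0,d)$, and let $p=\frac{2d}{\alpha}$. Then there exist a sequence of functions $f_N:\mathbb{Z}_N^d\to\mathbb{C}$, $N\in\mathbb{N}$, with $|\operatorname{supp}(\widehat{f_N})|\approx N^\alpha$, and constants $C>0$ and $C_0>0$ independent of $N$, such that $$\|f_N\|_{L^p(\mathbb{Z}_N^d)}\le C\quad\text{and}\quad\|f_N\|_{L^\infty(\mathbb{Z}_N^d)}>C_0$$ for all $N\in\mathbb{N}$.
   Context: $\mathbb{Z}_N^d$ is the $d$-fold product of the cyclic group $\mathbb{Z}_N=\mathbb{Z}/N\mathbb{Z}$; $\mathbb{N}$ is the set of positive integers. For $f:\mathbb{Z}_N^d\to\mathbb{C}$ the Fourier transform $\widehat f:\mathbb{Z}_N^d\to\mathbb{C}$ is $\widehat f(m)=N^{-d/2}\sum_{x\in\mathbb{Z}_N^d} f(x)e^{-2\pi i\, x\cdot m/N}$, where $x\cdot m=\sum_{j=1}^d x_jm_j$. Norms are with respect to counting measure: $\|f\|_{L^p(\mathbb{Z}_N^d)}=\left(\sum_{x\in\mathbb{Z}_N^d}|f(x)|^p\right)^{1/p}$ for $1\le p<\infty$ and $\|f\|_{L^\infty(\mathbb{Z}_N^d)}=\max_{x\in\mathbb{Z}_N^d}|f(x)|$. $\operatorname{supp}$ denotes the set of points where a function is nonzero. The notation $|\operatorname{supp}(\widehat{f_N})|\approx N^\alpha$ means that there are constants $C_1,C_2>0$ independent of $N$ with $C_1N^\alpha\le|\operatorname{supp}(\widehat{f_N})|\le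 C_2N^\alpha$ for all $N$. *)

theory Defs
  imports Complex_Main "HOL-Library.FuncSet" "HOL-Number_Theory.Residues"
begin

text \<open>
  Elements of the \<open>d\<close>-fold product of \<open>\<int>/N\<int>\<close> are tuples of residue
  representatives, indexed by \<open>0, ..., d - 1\<close>.  A function on this group is a function on
  \<^typ>\<open>nat \<Rightarrow> int\<close> of which only the values on \<open>ZNd N d\<close> are ever used.
\<close>

definition ZNd :: "nat \<Rightarrow> nat \<Rightarrow> (nat \<Rightarrow> int) set" where
  "ZNd N d = (\<Pi>\<^sub>E j\<in>{..<d}. carrier (residue_ring (int N)))"

text \<open>
  The dot product is an integer computed from representatives; it enters only through
  \<open>exp (- 2 \<pi> i (x \<cdot> m) / N)\<close>, which depends on it only modulo \<open>N\<close>.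
\<close>

definition dot_ZNd :: "nat \<Rightarrow> (nat \<Rightarrow> int) \<Rightarrow> (nat \<Rightarrow> int) \<Rightarrow> int" where
  "dot_ZNd d x m = (\<Sum>j<d. x j * m j)"

definition fourier_ZNd ::
    "nat \<Rightarrow> nat \<Rightarrow> ((nat \<Rightarrow> int) \<Rightarrow> complex) \<Rightarrow> (nat \<Rightarrow> int) \<Rightarrow> complex" where
  "fourier_ZNd N d f m =
     complex_of_real (real N powr (- real d / 2)) *
     (\<Sum>x\<in>ZNd N d. f x * exp (- 2 * complex_of_real pi * \<i> * of_int (dot_ZNd d x m) / of_nat N))"

definition supp_ZNd :: "nat \<Rightarrow> nat \<Rightarrow> ((nat \<Rightarrow> int) \<Rightarrow> complex) \<Rightarrow> (nat \<Rightarrow> int) set" where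
  "supp_ZNd N d g = {x \<in> ZNd N d. g x \<noteq> 0}"

definition Lp_norm_ZNd ::
    "nat \<Rightarrow> nat \<Rightarrow> real \<Rightarrow> ((nat \<Rightarrow> int) \<Rightarrow> complex) \<Rightarrow> real" where
  "Lp_norm_ZNd N d p f = (\<Sum>x\<in>ZNd N d. norm (f x) powr p) powr (1 / p)"

definition Linf_norm_ZNd :: "nat \<Rightarrow> nat \<Rightarrow> ((nat \<Rightarrow> int) \<Rightarrow> complex) \<Rightarrow> real" where
  "Linf_norm_ZNd N d f = Max ((\<lambda>x. norm (f x)) ` ZNd N d)"

end

theory Submission
  imports Defs "HOL-Analysis.Convex"
begin

text \<open>
  Take \<open>n = \<lceil>N powr \<alpha>\<rceil>\<close> random frequencies \<open>m\<^sub>i\<close> in \<open>G = ZNd N d\<close> and let \<open>f\<close> be the average of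
  the corresponding characters. Then \<open>f 0 = 1\<close>, while for \<open>x \<noteq> 0\<close> the sum \<open>S x = n * f x\<close> consists of
  independent centred unit vectors and so has size about \<open>sqrt n\<close>, with subgaussian tails.
  Hence some choice of frequencies makes the sum of \<open>\<bar>S x\<bar> powr q\<close> over \<open>x \<noteq> 0\<close> at most a
  constant times \<open>card G * n powr (q / 2)\<close>, for all \<open>q > 0\<close> at once. The case \<open>q = p\<close> bounds the
  \<open>L\<^sup>p\<close> norm, because \<open>n powr (p / 2) \<ge> N ^ d\<close>. The case \<open>q = 2\<close> shows that a positive
  proportion of the frequencies are distinct; these are exactly the support of the Fourier
  transform, since repetitions only add up positive coefficients.
\<close>

section \<open>The group, its characters and their orthogonality\<close>

lemma ZNd_eq: "ZNd N d = (\<Pi>\<^sub>E j\<in>{..<d}. {0..<int N})"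
  unfolding ZNd_def residue_ring_def by (auto simp: PiE_def Pi_def)

lemma finite_ZNd [simp]: "finite (ZNd N d)"
  by (simp add: ZNd_eq finite_PiE)

lemma card_ZNd: "card (ZNd N d) = N ^ d"
  by (simp add: ZNd_eq card_PiE)

text \<open>Members of \<open>ZNd N d\<close> take the value \<open>undefined\<close> outside
  \<open>{..<d}\<close>, hence a restricted function rather than a constant one.\<close>

definition zero_ZNd :: "nat \<Rightarrow> nat \<Rightarrow> int" where
  "zero_ZNd d = (\<lambda>j\<in>{..<d}. 0)"

lemma zero_in_ZNd: "N \<ge> 1 \<Longrightarrow> zero_ZNd d \<in> ZNd N d"
  by (simp add: ZNd_eq zero_ZNd_def)

text \<open>The conjugate of the kernel in \<open>fourier_ZNd\<close>. Both arguments may be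
  arbitrary integer vectors, so differences of frequencies need no reduction modulo
  \<open>N\<close>.\<close>

definition char_ZNd :: "nat \<Rightarrow> nat \<Rightarrow> (nat \<Rightarrow> int) \<Rightarrow> (nat \<Rightarrow> int) \<Rightarrow> complex" where
  "char_ZNd N d x m = cis (2 * pi * of_int (dot_ZNd d x m) / real N)"

lemma norm_char [simp]: "norm (char_ZNd N d x m) = 1"
  by (simp add: char_ZNd_def)

lemma char_commute: "char_ZNd N d x m = char_ZNd N d m x"
  by (simp add: char_ZNd_def dot_ZNd_def mult.commute)

lemma char_zero [simp]: "char_ZNd N d (zero_ZNd d) m = 1"
  by (simp add: char_ZNd_def dot_ZNd_def zero_ZNd_def)

lemma char_diff: "char_ZNd N d x m * cnj (char_ZNd N d x m') = char_ZNd N d x (\<lambda>j. m j - m' j)"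
  by (simp add: char_ZNd_def cis_cnj cis_mult dot_ZNd_def sum_subtractf
      right_diff_distrib diff_divide_distrib)

text \<open>A full geometric sum over the powers of an \<open>N\<close>-th root of unity other than
  1.\<close>

lemma sum_cis_interval:
  assumes "N \<ge> 1" and "\<not> int N dvd h"
  shows "(\<Sum>k\<in>{0..<int N}. cis (2 * pi * of_int (k * h) / real N)) = 0"
proof -
  define w where "w = cis (2 * pi * of_int h / real N)"
  have w_ne: "w \<noteq> 1"
  proof
    assume "w = 1"
    then have "cos (2 * pi * of_int h / real N) = 1"
      unfolding w_def by (metis cis.sel(1) one_complex.sel(1))
    then obtain k :: int where "2 * pi * of_int h / real N = of_int k * 2 * pi"
      by (auto simp: cos_one_2pi_int)
    then have "real_of_int h = of_int k * real N"
      using assms(1) by (simp add: field_simps)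
    then have "h = k * int N"
      by (metis of_int_eq_iff of_int_mult of_int_of_nat_eq)
    with assms(2) show False by simp
  qed
  have w_pow: "w ^ N = 1"
  proof -
    have "w ^ N = cis (2 * pi * of_int h)"
      using assms(1) by (simp add: w_def DeMoivre)
    then show ?thesis by (simp add: cis_multiple_2pi)
  qed
  have "{0..<int N} = int ` {..<N}"
    by (simp add: lessThan_atLeast0 image_int_atLeastLessThan)
  then have "(\<Sum>k\<in>{0..<int N}. cis (2 * pi * of_int (k * h) / real N))
           = (\<Sum>k<N. cis (2 * pi * of_int (int k * h) / real N))"
    by (simp add: sum.reindex)
  also have "\<dots> = (\<Sum>k<N. w ^ k)"
    by (intro sum.cong) (simp_all add: w_def DeMoivre mult_ac)
  also have "\<dots> = 0"
    using geometric_sum[OF w_ne, of N] w_pow by simp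
  finally show ?thesis .
qed

text \<open>The character is a product over the coordinates, so the sum over the box factorises, and
  the factor at coordinate \<open>j\<close> vanishes.\<close>

lemma sum_char_eq_0:
  assumes "N \<ge> 1" and j: "j < d" and "\<not> int N dvd h j"
  shows "(\<Sum>x\<in>ZNd N d. char_ZNd N d x h) = 0"
proof -
  have prod_cis: "cis (\<Sum>j\<in>A. f j) = (\<Prod>j\<in>A. cis (f j))" if "finite A" for f :: "nat \<Rightarrow> real" and A
    using that by induction (simp_all flip: cis_mult)
  have "(\<Sum>x\<in>ZNd N d. char_ZNd N d x h)
      = (\<Sum>x\<in>ZNd N d. \<Prod>j<d. cis (2 * pi * of_int (x j * h j) / real N))"
    by (simp add: char_ZNd_def dot_ZNd_def sum_distrib_left sum_divide_distrib flip: prod_cis)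
  also have "\<dots> = (\<Prod>j<d. \<Sum>k\<in>{0..<int N}. cis (2 * pi * of_int (k * h j) / real N))"
    unfolding ZNd_eq by (subst prod_sum_PiE) auto
  also have "\<dots> = 0"
    using sum_cis_interval[OF assms(1,3)] j by (intro prod_zero) auto
  finally show ?thesis .
qed

lemma char_orthogonality:
  assumes "N \<ge> 1" and m: "m \<in> ZNd N d" and m': "m' \<in> ZNd N d"
  shows "(\<Sum>x\<in>ZNd N d. char_ZNd N d x m * cnj (char_ZNd N d x m'))
       = (if m = m' then of_nat (N ^ d) else 0)"
proof (cases "m = m'")
  case True
  have "char_ZNd N d x m * cnj (char_ZNd N d x m) = 1" for x
    by (simp flip: complex_norm_square)
  with True show ?thesis by (simp add: card_ZNd)
next
  case False
  then obtain j where j: "j < d" "m j \<noteq> m' j"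
    using m m' unfolding ZNd_eq by (metis PiE_ext lessThan_iff)
  have "m j \<in> {0..<int N}" "m' j \<in> {0..<int N}"
    using m m' j unfolding ZNd_eq by (auto simp: PiE_def Pi_def)
  \<comment> \<open>Distinct representatives differ by less than \<open>N\<close>, so they are
    incongruent modulo \<open>N\<close>.\<close>
  then have "\<bar>m j - m' j\<bar> < \<bar>int N\<bar>" by auto
  then have "\<not> int N dvd m j - m' j"
    using j dvd_imp_le_int[of "m j - m' j" "int N"] by auto
  then show ?thesis
    using sum_char_eq_0[OF assms(1) j(1), of "\<lambda>j. m j - m' j"] False
    by (simp add: char_diff)
qed

text \<open>Orthogonality for the frequencies \<open>x\<close> and \<open>zero_ZNd d\<close>, read
  with the arguments exchanged. It makes the value at \<open>x\<close> of a random character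
  centred.\<close>

lemma sum_char_right_eq_0:
  assumes "N \<ge> 1" and x: "x \<in> ZNd N d" "x \<noteq> zero_ZNd d"
  shows "(\<Sum>m\<in>ZNd N d. char_ZNd N d x m) = 0"
proof -
  have "(\<Sum>m\<in>ZNd N d. char_ZNd N d m x * cnj (char_ZNd N d m (zero_ZNd d))) = 0"
    using char_orthogonality[OF assms(1) x(1) zero_in_ZNd[OF assms(1)]] x(2) by simp
  then show ?thesis by (simp add: char_commute[of N d _ x] char_commute[of N d _ "zero_ZNd d"])
qed

section \<open>Elementary inequalities for the exponential\<close>

text \<open>The linear term is kept exactly, so that it cancels when summed over a centred
  variable.\<close>

lemma exp_le_quadratic:
  fixes t :: real
  assumes "\<bar>t\<bar> \<le> 1"
  shows "exp t \<le> 1 + t + t\<^sup>2"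
proof (cases "t \<ge> 0")
  case True
  then show ?thesis using assms exp_bound by auto
next
  case False
  define s where "s = - t"
  have s: "0 \<le> s" "s \<le> 1" using False assms by (auto simp: s_def)
  \<comment> \<open>The product of \<open>1 - s + s^2\<close> with the quadratic Taylor polynomial
    of \<open>exp s\<close> exceeds 1 by a polynomial with nonnegative coefficients.\<close>
  have "0 \<le> s\<^sup>2 / 2 + s ^ 3 / 2 + s ^ 4 / 2" using s by simp
  also have "\<dots> = (1 - s + s\<^sup>2) * (1 + s + s\<^sup>2 / 2) - 1"
    by (simp add: field_simps power2_eq_square power3_eq_cube power4_eq_xxxx)
  finally have "1 \<le> (1 - s + s\<^sup>2) * (1 + s + s\<^sup>2 / 2)" by simp
  also have "\<dots> \<le> (1 - s + s\<^sup>2) * exp s"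
    using s exp_lower_Taylor_quadratic[of s] by (intro mult_left_mono) auto
  finally have "exp (- s) \<le> 1 - s + s\<^sup>2"
    by (simp add: exp_minus divide_simps)
  then show ?thesis by (simp add: s_def)
qed

text \<open>The inequality \<open>y \<le> exp y\<close> at \<open>y = t / (2 * q)\<close>, raised to
  the power \<open>q\<close>. It lets one exponential bound control all power sums.\<close>

lemma powr_le_exp_half:
  fixes t q :: real
  assumes "t \<ge> 0" and "q > 0"
  shows "t powr q \<le> (2 * q) powr q * exp (t / 2)"
proof -
  have "t / (2 * q) \<le> exp (t / (2 * q))"
    using exp_ge_add_one_self[of "t / (2 * q)"] by linarith
  then have "(t / (2 * q)) powr q \<le> exp (t / (2 * q)) powr q"
    using assms by (intro powr_mono2) auto
  also have "\<dots> = exp (t / 2)"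
    using assms by (simp add: powr_def)
  finally show ?thesis
    using assms by (simp add: powr_divide divide_simps mult_ac)
qed

text \<open>Half the modulus is at most the larger of \<open>\<bar>Re z\<bar>\<close> and
  \<open>\<bar>Im z\<bar>\<close>, and the four units turn both, with either sign, into real parts.
  These are additive in \<open>z\<close>, so independence applies to their exponentials.\<close>

lemma exp_half_norm_le:
  fixes z :: complex
  shows "exp (norm z / 2) \<le> (\<Sum>u\<in>{1, -1, \<i>, -\<i>}. exp (Re (u * z)))"
proof -
  have distinct: "(1::complex) \<noteq> -1" "1 \<noteq> \<i>" "1 \<noteq> -\<i>" "-1 \<noteq> \<i>" "-1 \<noteq> -\<i>" "\<i> \<noteq> -\<i>"
    by (auto simp: complex_eq_iff)
  have S: "(\<Sum>u\<in>{1, -1, \<i>, -\<i>}. exp (Re (u * z)))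
         = exp (Re z) + exp (- Re z) + exp (- Im z) + exp (Im z)"
    using distinct by simp
  have "norm z / 2 \<le> max \<bar>Re z\<bar> \<bar>Im z\<bar>"
    using cmod_le[of z] by (auto simp: max_def)
  then have "exp (norm z / 2) \<le> exp (max \<bar>Re z\<bar> \<bar>Im z\<bar>)" by simp
  also have "\<dots> \<le> exp (Re z) + exp (- Re z) + exp (- Im z) + exp (Im z)"
    using exp_gt_zero[of "Re z"] exp_gt_zero[of "- Re z"]
      exp_gt_zero[of "- Im z"] exp_gt_zero[of "Im z"]
    unfolding max_def abs_if by simp
  finally show ?thesis unfolding S .
qed

section \<open>Exponential moments and the choice of frequencies\<close>

text \<open>A sum over all tuples is, up to normalisation, an expectation over \<open>n\<close> independent
  uniform points of \<open>G\<close>; independence factorises the exponential moment.\<close>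

lemma exponential_moment_tuples:
  fixes \<chi> :: "'a \<Rightarrow> complex"
  assumes fin: "finite G" and n: "n \<ge> 1"
    and bound: "\<And>g. g \<in> G \<Longrightarrow> norm (\<chi> g) \<le> 1"
    and mean: "(\<Sum>g\<in>G. \<chi> g) = 0" and u: "norm u \<le> 1"
  shows "(\<Sum>m\<in>{..<n} \<rightarrow>\<^sub>E G. exp (Re (u * (\<Sum>i<n. \<chi> (m i)) / of_real (sqrt n))))
       \<le> exp 1 * real (card G) ^ n"
proof -
  define r where "r g = Re (u * \<chi> g) / sqrt n" for g
  have r_abs: "\<bar>r g\<bar> \<le> 1 / sqrt n" if "g \<in> G" for g
  proof -
    have "\<bar>Re (u * \<chi> g)\<bar> \<le> norm u * norm (\<chi> g)"
      by (metis abs_Re_le_cmod norm_mult)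
    also have "\<dots> \<le> 1"
      using u bound[OF that] by (intro mult_le_one) auto
    finally show ?thesis using n by (simp add: r_def abs_divide divide_right_mono)
  qed
  have "1 / sqrt n \<le> 1" using n by simp
  have "(\<Sum>g\<in>G. r g) = Re (u * (\<Sum>g\<in>G. \<chi> g)) / sqrt n"
    unfolding r_def by (simp only: Re_sum sum_distrib_left sum_divide_distrib)
  then have r_sum: "(\<Sum>g\<in>G. r g) = 0" by (simp add: mean)
  have "(\<Sum>g\<in>G. exp (r g)) \<le> (\<Sum>g\<in>G. 1 + r g + 1 / n)"
  proof (rule sum_mono)
    fix g assume g: "g \<in> G"
    have "exp (r g) \<le> 1 + r g + (r g)\<^sup>2"
      using r_abs[OF g] \<open>1 / sqrt n \<le> 1\<close> by (intro exp_le_quadratic) linarith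
    moreover have "(r g)\<^sup>2 \<le> (1 / sqrt n)\<^sup>2"
      using r_abs[OF g] by (metis abs_ge_zero power2_abs power_mono)
    ultimately show "exp (r g) \<le> 1 + r g + 1 / n"
      by (simp add: power_divide)
  qed
  also have "\<dots> = card G * (1 + 1 / n)"
    by (simp add: sum.distrib r_sum algebra_simps)
  \<comment> \<open>In this form the \<open>n\<close> equal factors multiply to
    \<open>exp 1\<close>, uniformly in \<open>n\<close>.\<close>
  also have "\<dots> \<le> card G * exp (1 / n)"
    by (intro mult_left_mono exp_ge_add_one_self) auto
  finally have one: "(\<Sum>g\<in>G. exp (r g)) \<le> card G * exp (1 / n)" .
  have "(\<Sum>m\<in>{..<n} \<rightarrow>\<^sub>E G. exp (Re (u * (\<Sum>i<n. \<chi> (m i)) / of_real (sqrt n))))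
      = (\<Sum>m\<in>{..<n} \<rightarrow>\<^sub>E G. \<Prod>i<n. exp (r (m i)))"
    by (simp add: r_def sum_distrib_left sum_divide_distrib flip: exp_sum)
  also have "\<dots> = (\<Sum>g\<in>G. exp (r g)) ^ n"
    using fin by (subst prod_sum_PiE[symmetric]) auto
  also have "\<dots> \<le> (card G * exp (1 / n)) ^ n"
    by (intro power_mono one sum_nonneg) auto
  also have "\<dots> = exp 1 * card G ^ n"
    using n by (simp add: power_mult_distrib flip: exp_of_nat_mult)
  finally show ?thesis by simp
qed

text \<open>Averaging over all tuples: each nonzero \<open>x\<close> adds at most
  \<open>4 * exp 1\<close> to the mean, one \<open>exp 1\<close> for each unit in
  \<open>exp_half_norm_le\<close>, and some tuple does no worse than the mean.\<close>

lemma exists_tuple_small_char_sums: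
  fixes n :: nat
  assumes N: "N \<ge> 1" and n: "n \<ge> 1"
  shows "\<exists>m\<in>{..<n} \<rightarrow>\<^sub>E ZNd N d.
    (\<Sum>x\<in>ZNd N d - {zero_ZNd d}. exp (norm (\<Sum>i<n. char_ZNd N d x (m i)) / sqrt n / 2))
      \<le> 4 * exp 1 * real (N ^ d)"
proof -
  define T where "T = ({..<n} \<rightarrow>\<^sub>E ZNd N d)"
  define X where "X = ZNd N d - {zero_ZNd d}"
  define S where "S m x = (\<Sum>i<n. char_ZNd N d x (m i))" for m x
  have T: "finite T" "card T = (N ^ d) ^ n"
    by (simp_all add: T_def finite_PiE card_PiE card_ZNd)
  have "T \<noteq> {}" using T N by force
  have moment: "(\<Sum>m\<in>T. exp (norm (S m x) / sqrt n / 2)) \<le> 4 * exp 1 * card T" if x: "x \<in> X" for x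
  proof -
    have "exp (norm (S m x) / sqrt n / 2)
        \<le> (\<Sum>u\<in>{1, -1, \<i>, -\<i>}. exp (Re (u * S m x / of_real (sqrt n))))" for m
      using exp_half_norm_le[of "S m x / of_real (sqrt n)"] by (simp add: norm_divide)
    then have "(\<Sum>m\<in>T. exp (norm (S m x) / sqrt n / 2))
        \<le> (\<Sum>m\<in>T. \<Sum>u\<in>{1, -1, \<i>, -\<i>}. exp (Re (u * S m x / of_real (sqrt n))))"
      by (intro sum_mono)
    also have "\<dots> = (\<Sum>u\<in>{1, -1, \<i>, -\<i>}. \<Sum>m\<in>T. exp (Re (u * S m x / of_real (sqrt n))))"
      by (rule sum.swap)
    also have "\<dots> \<le> (\<Sum>u\<in>{1, -1, \<i>, -\<i>}. exp 1 * card T)"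
    proof (rule sum_mono)
      fix u :: complex assume "u \<in> {1, -1, \<i>, -\<i>}"
      then have "norm u \<le> 1" by auto
      then show "(\<Sum>m\<in>T. exp (Re (u * S m x / of_real (sqrt n)))) \<le> exp 1 * card T"
        using exponential_moment_tuples[of "ZNd N d" n "char_ZNd N d x" u] x n
          sum_char_right_eq_0[OF N, of x]
        by (simp add: X_def T_def S_def card_PiE)
    qed
    also have "\<dots> \<le> 4 * (exp 1 * card T)"
    proof -
      have "card {1, -1, \<i>, -\<i>} \<le> 4" by (simp add: card_insert_if)
      then have "real (card {1, -1, \<i>, -\<i>}) \<le> 4" by linarith
      then show ?thesis unfolding sum_constant by (rule mult_right_mono) simp
    qed
    finally show ?thesis by simp
  qed
  have "\<exists>m\<in>T. (\<Sum>x\<in>X. exp (norm (S m x) / sqrt n / 2)) \<le> 4 * exp 1 * real (N ^ d)"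
  proof (rule ccontr)
    assume "\<not> ?thesis"
    then have "(\<Sum>m\<in>T. 4 * exp 1 * real (N ^ d)) < (\<Sum>m\<in>T. \<Sum>x\<in>X. exp (norm (S m x) / sqrt n / 2))"
      using T \<open>T \<noteq> {}\<close> by (intro sum_strict_mono) auto
    also have "\<dots> = (\<Sum>x\<in>X. \<Sum>m\<in>T. exp (norm (S m x) / sqrt n / 2))"
      by (rule sum.swap)
    also have "\<dots> \<le> (\<Sum>x\<in>X. 4 * exp 1 * card T)"
      by (intro sum_mono moment)
    also have "\<dots> \<le> N ^ d * (4 * exp 1 * card T)"
    proof -
      have "card X \<le> N ^ d"
        unfolding X_def by (metis card_Diff1_le card_ZNd)
      then have "real (card X) \<le> real (N ^ d)" by (rule of_nat_mono)
      then show ?thesis by (simp add: mult_right_mono)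
    qed
    finally show False by (simp add: mult_ac)
  qed
  then show ?thesis by (simp add: T_def X_def S_def)
qed

section \<open>Fourier support and the number of distinct frequencies\<close>

text \<open>Orthogonality leaves only the indices with \<open>m i = k\<close>, so the coefficient
  measures the multiplicity of \<open>k\<close>.\<close>

lemma fourier_char_average:
  assumes N: "N \<ge> 1" and m: "\<And>i. i < n \<Longrightarrow> m i \<in> ZNd N d" and k: "k \<in> ZNd N d"
  shows "fourier_ZNd N d (\<lambda>x. (\<Sum>i<n. char_ZNd N d x (m i)) / of_nat n) k
       = of_real (real N powr (- real d / 2)) * of_nat (N ^ d * card {i. i < n \<and> m i = k}) / of_nat n"
proof -
  have kernel: "exp (- 2 * complex_of_real pi * \<i> * of_int (dot_ZNd d x k) / of_nat N)
      = cnj (char_ZNd N d x k)" for x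
    unfolding char_ZNd_def cis_cnj unfolding cis_conv_exp by (simp add: mult_ac)
  have "(\<Sum>x\<in>ZNd N d. (\<Sum>i<n. char_ZNd N d x (m i)) / of_nat n * cnj (char_ZNd N d x k))
      = (\<Sum>x\<in>ZNd N d. \<Sum>i<n. char_ZNd N d x (m i) * cnj (char_ZNd N d x k)) / of_nat n"
    by (simp add: sum_distrib_right sum_divide_distrib)
  also have "\<dots> = (\<Sum>i<n. \<Sum>x\<in>ZNd N d. char_ZNd N d x (m i) * cnj (char_ZNd N d x k)) / of_nat n"
    by (subst sum.swap) rule
  also have "\<dots> = (\<Sum>i<n. if m i = k then of_nat (N ^ d) else 0) / of_nat n"
    using char_orthogonality[OF N m k] by simp
  also have "\<dots> = of_nat (N ^ d * card {i. i < n \<and> m i = k}) / of_nat n"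
    by (simp add: sum.If_cases Int_def mult.commute)
  finally show ?thesis
    unfolding fourier_ZNd_def kernel by simp
qed

lemma supp_fourier_char_average:
  assumes N: "N \<ge> 1" and n: "n \<ge> 1" and m: "\<And>i. i < n \<Longrightarrow> m i \<in> ZNd N d"
  shows "supp_ZNd N d (fourier_ZNd N d (\<lambda>x. (\<Sum>i<n. char_ZNd N d x (m i)) / of_nat n))
       = m ` {..<n}"
proof -
  have "{i. i < n \<and> m i = k} = {} \<longleftrightarrow> k \<notin> m ` {..<n}" for k by auto
  then show ?thesis
    unfolding supp_ZNd_def using N n m
    by (auto simp: fourier_char_average card_eq_0_iff)
qed

text \<open>Cauchy--Schwarz for the multiplicities of the \<open>m i\<close>, whose sum of squares is given by
  Parseval.\<close>

lemma card_distinct_frequencies: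
  assumes N: "N \<ge> 1" and m: "\<And>i. i < n \<Longrightarrow> m i \<in> ZNd N d"
  shows "real (N ^ d) * (real n)\<^sup>2
       \<le> card (m ` {..<n}) * (\<Sum>x\<in>ZNd N d. (norm (\<Sum>i<n. char_ZNd N d x (m i)))\<^sup>2)"
proof -
  define A where "A = m ` {..<n}"
  define c where "c k = real (card {i. i < n \<and> m i = k})" for k
  have c: "c k = (\<Sum>i<n. if m i = k then 1 else 0)" for k
    by (simp add: c_def sum.If_cases Int_def)
  have "(\<Sum>k\<in>A. c k) = (\<Sum>i<n. \<Sum>k\<in>A. if m i = k then 1 else 0)"
    unfolding c by (rule sum.swap)
  also have "\<dots> = n" by (simp add: A_def)
  finally have c_sum: "(\<Sum>k\<in>A. c k) = n" .
  \<comment> \<open>Both sides of \<open>c_sq\<close> count the pairs of indices with equal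
    frequencies; the sum over \<open>i\<close> is the form in which Parseval delivers this
    number.\<close>
  have "(\<Sum>k\<in>A. (c k)\<^sup>2) = (\<Sum>k\<in>A. \<Sum>i<n. if m i = k then c k else 0)"
    by (simp add: power2_eq_square c sum_distrib_left if_distrib cong: if_cong)
  also have "\<dots> = (\<Sum>i<n. \<Sum>k\<in>A. if m i = k then c k else 0)"
    by (rule sum.swap)
  also have "\<dots> = (\<Sum>i<n. c (m i))" by (simp add: A_def)
  finally have c_sq: "(\<Sum>k\<in>A. (c k)\<^sup>2) = (\<Sum>i<n. c (m i))" .
  have "complex_of_real (\<Sum>x\<in>ZNd N d. (norm (\<Sum>i<n. char_ZNd N d x (m i)))\<^sup>2)
      = (\<Sum>x\<in>ZNd N d. \<Sum>i<n. \<Sum>j<n. char_ZNd N d x (m j) * cnj (char_ZNd N d x (m i)))"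
    unfolding of_real_sum complex_norm_square
    by (simp add: sum_distrib_left sum_distrib_right mult_ac)
  also have "\<dots> = (\<Sum>i<n. \<Sum>x\<in>ZNd N d. \<Sum>j<n. char_ZNd N d x (m j) * cnj (char_ZNd N d x (m i)))"
    by (rule sum.swap)
  also have "\<dots> = (\<Sum>i<n. \<Sum>j<n. \<Sum>x\<in>ZNd N d. char_ZNd N d x (m j) * cnj (char_ZNd N d x (m i)))"
    by (intro sum.cong refl sum.swap)
  also have "\<dots> = (\<Sum>i<n. \<Sum>j<n. if m j = m i then of_nat (N ^ d) else 0)"
    by (intro sum.cong refl char_orthogonality N m) auto
  also have "\<dots> = of_real (real (N ^ d) * (\<Sum>i<n. c (m i)))"
    by (simp add: c sum_distrib_left if_distrib cong: if_cong)
  finally have parseval: "(\<Sum>x\<in>ZNd N d. (norm (\<Sum>i<n. char_ZNd N d x (m i)))\<^sup>2)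
      = real (N ^ d) * (\<Sum>k\<in>A. (c k)\<^sup>2)"
    unfolding c_sq of_real_eq_iff .
  have "(\<Sum>k\<in>A. c k)\<^sup>2 \<le> (\<Sum>k\<in>A. (c k)\<^sup>2) * card A"
    by (rule sum_squared_le_sum_of_squares)
  then have "real (N ^ d) * (real n)\<^sup>2 \<le> real (N ^ d) * ((\<Sum>k\<in>A. (c k)\<^sup>2) * card A)"
    unfolding c_sum by (intro mult_left_mono) auto
  then show ?thesis
    unfolding parseval A_def[symmetric] by (simp add: mult_ac)
qed

section \<open>Power sums and the final estimates\<close>

lemma sum_norm_powr_le:
  fixes S :: "'a \<Rightarrow> complex"
  assumes n: "n \<ge> 1" and q: "q > 0"
    and S: "(\<Sum>x\<in>X. exp (norm (S x) / sqrt (real n) / 2)) \<le> B"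
  shows "(\<Sum>x\<in>X. norm (S x) powr q) \<le> (2 * q) powr q * B * real n powr (q / 2)"
proof -
  have "norm (S x) powr q \<le> (2 * q) powr q * exp (norm (S x) / sqrt n / 2) * n powr (q / 2)" for x
  proof -
    have "sqrt n powr q = n powr (q / 2)"
      by (simp add: powr_powr flip: powr_half_sqrt)
    then have "norm (S x) powr q = (norm (S x) / sqrt n) powr q * n powr (q / 2)"
      using n by (simp add: powr_divide)
    also have "\<dots> \<le> (2 * q) powr q * exp (norm (S x) / sqrt n / 2) * n powr (q / 2)"
      using powr_le_exp_half[OF _ q, of "norm (S x) / sqrt n"] by (intro mult_right_mono) auto
    finally show ?thesis .
  qed
  then have "(\<Sum>x\<in>X. norm (S x) powr q)
      \<le> (\<Sum>x\<in>X. (2 * q) powr q * exp (norm (S x) / sqrt n / 2) * n powr (q / 2))"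
    by (intro sum_mono)
  also have "\<dots> = (2 * q) powr q * (\<Sum>x\<in>X. exp (norm (S x) / sqrt n / 2)) * n powr (q / 2)"
    by (simp add: sum_distrib_left sum_distrib_right)
  also have "\<dots> \<le> (2 * q) powr q * B * n powr (q / 2)"
    by (intro mult_right_mono mult_left_mono S) auto
  finally show ?thesis .
qed

lemma exists_concentrated_function:
  fixes \<alpha> p :: real
  assumes N: "N \<ge> 1" and \<alpha>: "0 < \<alpha>" "\<alpha> < real d" and p: "p = 2 * real d / \<alpha>"
  shows "\<exists>f. real N powr \<alpha> / (1 + 64 * exp 1) \<le> card (supp_ZNd N d (fourier_ZNd N d f)) \<and>
             card (supp_ZNd N d (fourier_ZNd N d f)) \<le> 2 * real N powr \<alpha> \<and>
             Lp_norm_ZNd N d p f \<le> (1 + (2 * p) powr p * (4 * exp 1)) powr (1 / p) \<and>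
             Linf_norm_ZNd N d f > 1 / 2"
proof -
  define n where "n = nat \<lceil>real N powr \<alpha>\<rceil>"
  have N\<alpha>: "1 \<le> real N powr \<alpha>" using N \<alpha> by (simp add: ge_one_powr_ge_zero)
  \<comment> \<open>Rounding up adds less than 1, which is at most \<open>N powr \<alpha>\<close>;
    hence the factor 2.\<close>
  then have n_ge: "real N powr \<alpha> \<le> n" and n_le2: "n \<le> 2 * real N powr \<alpha>" and n: "n \<ge> 1"
    unfolding n_def by linarith+
  have p_pos: "p > 0" using \<alpha> p by simp
  \<comment> \<open>Since \<open>N ^ d\<close> is an integer, it still dominates after rounding
    up.\<close>
  have "real N powr \<alpha> \<le> real N powr d" using N \<alpha> by (intro powr_mono) auto
  also have "\<dots> = of_int (int (N ^ d))" using N by (simp add: powr_realpow)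
  finally have "n \<le> N ^ d" unfolding n_def by (simp only: ceiling_le_iff nat_le_iff)
  then have n_le: "real n \<le> real (N ^ d)" by (rule of_nat_mono)

  obtain m where m: "m \<in> {..<n} \<rightarrow>\<^sub>E ZNd N d"
    and small: "(\<Sum>x\<in>ZNd N d - {zero_ZNd d}. exp (norm (\<Sum>i<n. char_ZNd N d x (m i)) / sqrt n / 2))
      \<le> 4 * exp 1 * real (N ^ d)"
    using exists_tuple_small_char_sums[OF N n] by blast
  have mi: "m i \<in> ZNd N d" if "i < n" for i using m that by auto
  define S where "S x = (\<Sum>i<n. char_ZNd N d x (m i))" for x
  have S0: "S (zero_ZNd d) = of_nat n" by (simp add: S_def)
  define f where "f x = S x / of_nat n" for x
  have split: "(\<Sum>x\<in>ZNd N d. g x) = g (zero_ZNd d) + (\<Sum>x\<in>ZNd N d - {zero_ZNd d}. g x)"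
    for g :: "(nat \<Rightarrow> int) \<Rightarrow> real"
    by (intro sum.remove zero_in_ZNd N) auto
  have powr_sum: "(\<Sum>x\<in>ZNd N d - {zero_ZNd d}. norm (S x) powr q)
      \<le> (2 * q) powr q * (4 * exp 1 * real (N ^ d)) * n powr (q / 2)" if "q > 0" for q
    using small sum_norm_powr_le[OF n that, where S = S] by (simp add: S_def)

  have supp: "supp_ZNd N d (fourier_ZNd N d f) = m ` {..<n}"
    using supp_fourier_char_average[OF N n mi] by (simp add: f_def[abs_def] S_def[abs_def])
  have upper: "card (m ` {..<n}) \<le> 2 * real N powr \<alpha>"
    using card_image_le[of "{..<n}" m] n_le2 by simp

  have lower: "real N powr \<alpha> / (1 + 64 * exp 1) \<le> card (m ` {..<n})"
  proof -
    have "(\<Sum>x\<in>ZNd N d. (norm (S x))\<^sup>2) = n\<^sup>2 + (\<Sum>x\<in>ZNd N d - {zero_ZNd d}. norm (S x) powr 2)"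
      by (simp add: split S0)
    \<comment> \<open>At \<open>q = 2\<close> the constant is \<open>4 powr 2 * 4 = 64\<close>,
      times \<open>exp 1\<close>.\<close>
    also have "\<dots> \<le> n\<^sup>2 + 64 * exp 1 * real (N ^ d) * n"
      using powr_sum[of 2] by simp
    also have "\<dots> \<le> real (N ^ d) * n + 64 * exp 1 * real (N ^ d) * n"
      using n_le by (simp add: power2_eq_square mult_right_mono)
    finally have L2: "(\<Sum>x\<in>ZNd N d. (norm (S x))\<^sup>2) \<le> real (N ^ d) * n * (1 + 64 * exp 1)"
      by (simp add: algebra_simps)
    have "real (N ^ d) * n * n \<le> card (m ` {..<n}) * (\<Sum>x\<in>ZNd N d. (norm (S x))\<^sup>2)"
      using card_distinct_frequencies[OF N mi] by (simp add: S_def power2_eq_square mult_ac)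
    also have "\<dots> \<le> card (m ` {..<n}) * (real (N ^ d) * n * (1 + 64 * exp 1))"
      by (intro mult_left_mono L2) auto
    finally have "real (N ^ d) * n * n \<le> real (N ^ d) * n * (card (m ` {..<n}) * (1 + 64 * exp 1))"
      by (simp add: mult_ac)
    moreover have "real (N ^ d) * n > 0" using N n by simp
    ultimately have "n \<le> card (m ` {..<n}) * (1 + 64 * exp 1)"
      by (simp only: mult_le_cancel_left_pos)
    with n_ge have "real N powr \<alpha> \<le> card (m ` {..<n}) * (1 + 64 * exp 1)" by linarith
    moreover have "1 + 64 * exp 1 > (0::real)" by (simp add: add_pos_pos)
    ultimately show ?thesis by (simp only: pos_divide_le_eq)
  qed

  have Lp: "Lp_norm_ZNd N d p f \<le> (1 + (2 * p) powr p * (4 * exp 1)) powr (1 / p)"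
  proof -
    \<comment> \<open>The choice of \<open>p\<close> enters here: it is the exponent for which
      \<open>n powr (p / 2)\<close> reaches the size of the group.\<close>
    have dp: "\<alpha> * (p / 2) = d" using \<alpha> p by simp
    have "real (N ^ d) = (real N powr \<alpha>) powr (p / 2)"
      using N unfolding powr_powr dp by (simp add: powr_realpow)
    also have "\<dots> \<le> n powr (p / 2)"
      using n_ge p_pos by (intro powr_mono2) auto
    finally have Nd: "real (N ^ d) \<le> n powr (p / 2)" .
    have "(\<Sum>x\<in>ZNd N d - {zero_ZNd d}. norm (f x) powr p)
        = (\<Sum>x\<in>ZNd N d - {zero_ZNd d}. norm (S x) powr p) / n powr p"
      by (simp add: f_def norm_divide powr_divide sum_divide_distrib)
    also have "\<dots> \<le> (2 * p) powr p * (4 * exp 1 * real (N ^ d)) * n powr (p / 2) / n powr p"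
      by (intro divide_right_mono powr_sum p_pos) auto
    \<comment> \<open>One factor \<open>n powr (p / 2)\<close> reflects the size
      \<open>sqrt n\<close> of \<open>S\<close>, the other replaces the size of the group; together
      they cancel the normalisation of \<open>f\<close>.\<close>
    also have "\<dots> \<le> (2 * p) powr p * (4 * exp 1 * n powr (p / 2)) * n powr (p / 2) / n powr p"
      by (intro divide_right_mono mult_right_mono mult_left_mono Nd) auto
    also have "\<dots> = (2 * p) powr p * (4 * exp 1)"
    proof -
      have "n powr (p / 2) * n powr (p / 2) = n powr p" by (simp flip: powr_add)
      then show ?thesis using n by (simp add: mult.assoc)
    qed
    \<comment> \<open>The origin contributes the summand 1.\<close>
    finally have "(\<Sum>x\<in>ZNd N d. norm (f x) powr p) \<le> 1 + (2 * p) powr p * (4 * exp 1)"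
      using n by (simp add: split f_def S0)
    then show ?thesis
      unfolding Lp_norm_ZNd_def using p_pos by (intro powr_mono2 sum_nonneg) auto
  qed

  have "norm (f (zero_ZNd d)) \<le> Linf_norm_ZNd N d f"
    unfolding Linf_norm_ZNd_def by (intro Max_ge imageI zero_in_ZNd N) auto
  then have "Linf_norm_ZNd N d f > 1 / 2" using n by (simp add: f_def S0)
  with lower upper Lp show ?thesis unfolding supp[symmetric] by blast
qed

theorem proposition9:
  fixes d :: nat and \<alpha> p :: real
  assumes "d \<ge> 1" and "0 < \<alpha>" and "\<alpha> < real d" and "p = 2 * real d / \<alpha>"
  shows "\<exists>f :: nat \<Rightarrow> (nat \<Rightarrow> int) \<Rightarrow> complex.
           (\<exists>C1 > 0. \<exists>C2 > 0. \<forall>N \<ge> 1.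
              C1 * real N powr \<alpha> \<le> real (card (supp_ZNd N d (fourier_ZNd N d (f N)))) \<and>
              real (card (supp_ZNd N d (fourier_ZNd N d (f N)))) \<le> C2 * real N powr \<alpha>) \<and>
           (\<exists>C > 0. \<exists>C0 > 0. \<forall>N \<ge> 1.
              Lp_norm_ZNd N d p (f N) \<le> C \<and> Linf_norm_ZNd N d (f N) > C0)"
proof -
  define C :: real where "C = 1 + 64 * exp 1"
  define K where "K = (1 + (2 * p) powr p * (4 * exp 1)) powr (1 / p)"
  have "C > 0" by (simp add: C_def add_pos_pos)
  have "1 + (2 * p) powr p * (4 * exp 1) > 0" by (intro add_pos_nonneg) auto
  then have "K > 0" by (simp add: K_def)
  \<comment> \<open>The condition on \<open>N\<close> stands under the existential quantifier, so
    that choice yields a function of all \<open>N\<close>, arbitrary at 0.\<close>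
  have "\<forall>N. \<exists>f. N \<ge> 1 \<longrightarrow>
      real N powr \<alpha> / C \<le> card (supp_ZNd N d (fourier_ZNd N d f)) \<and>
      card (supp_ZNd N d (fourier_ZNd N d f)) \<le> 2 * real N powr \<alpha> \<and>
      Lp_norm_ZNd N d p f \<le> K \<and> Linf_norm_ZNd N d f > 1 / 2"
    unfolding C_def K_def using exists_concentrated_function[OF _ assms(2-4)] by blast
  then obtain f where f: "\<And>N. N \<ge> 1 \<Longrightarrow>
      real N powr \<alpha> / C \<le> card (supp_ZNd N d (fourier_ZNd N d (f N))) \<and>
      card (supp_ZNd N d (fourier_ZNd N d (f N))) \<le> 2 * real N powr \<alpha> \<and>
      Lp_norm_ZNd N d p (f N) \<le> K \<and> Linf_norm_ZNd N d (f N) > 1 / 2"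
    by metis
  show ?thesis
  proof (intro exI[of _ f] conjI)
    show "\<exists>C1 > 0. \<exists>C2 > 0. \<forall>N \<ge> 1.
        C1 * real N powr \<alpha> \<le> real (card (supp_ZNd N d (fourier_ZNd N d (f N)))) \<and>
        real (card (supp_ZNd N d (fourier_ZNd N d (f N)))) \<le> C2 * real N powr \<alpha>"
      using f \<open>C > 0\<close> by (intro exI[of _ "1 / C"] exI[of _ 2] conjI) auto
    show "\<exists>C > 0. \<exists>C0 > 0. \<forall>N \<ge> 1. Lp_norm_ZNd N d p (f N) \<le> C \<and> Linf_norm_ZNd N d (f N) > C0"
      using f \<open>K > 0\<close> by (intro exI[of _ K] exI[of _ "1 / 2"] conjI) auto
  qed
qed

end
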